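(* For every formula $\varphi$ in the language of propositional logic, $\varphi$ is a generalised proof-theoretically valid formula if and only if $\varphi$ is an intuitionistic validity (i.e. a theorem of intuitionistic propositional logic).
   Context: Let $ATOM$ be a countably infinite set of atomic propositions, and let $\bot\notin ATOM$ be a further symbol (falsum), which is treated as an atomic proposition rather than as a 0-ary connective. Formulas of propositional logic are built from $ATOM\cup\{\bot\}$ using the binary connectives $\wedge,\vee,\rightarrow$. An atomic rule is either an axiom, written $\bar p$ (no premises, conclusion $p$), with $p\in ATOM\cup\{\bot\}$, or an inference $\frac{p_1\ \cdots\ p_n}{p_{n+1}}$ (premises $p_1,\dots,p_n$ with $n\ge 1$, conclusion $p_{n+1}$), with $p_1,\dots,p_{n+1}\in ATOM\cup\{\bot\}$. The set of all atomic rules is $\mathbb{S}$. An atomic system is a subset $S\subseteq\mathbb{S}$. A proof-theoretic system is a set $\mathfrak{S}\subseteq\mathcal{P}(\mathbb{S})$ of atomic systems. For an atomic system $S$ and $p\in ATOM\cup\{\bot\}$, write $S\vdash p$ if there is a (closed, finite) proof of $p$ using only rules in $S$. For every proof-theoretic system $\mathfrak{S}$ and $S\in\mathfrak{S}$ the relation $\mathfrak{S},S\vDash\varphi$ is defined by recursion on $\varphi$: - $\mathfrak{S},S\vDash p \iff S\vdash p$ for $p\in ATOM$; - $\mathfrak{S},S\vDash\bot\iff S\vdash\bot$; - $\mathfrak{S},S\vDash\varphi\wedge\psi\iff \mathfrak{S},S\vDash\varphi$ and $\mathfrak{S},S\vDash\psi$; - $\mathfrak{S},S\vDash\varphi\vee\psi\iff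 \mathfrak{S},S\vDash\varphi$ or $\mathfrak{S},S\vDash\psi$; - $\mathfrak{S},S\vDash\psi\rightarrow\varphi\iff$ for all $S'\in\mathfrak{S}$ with $S'\supseteq S$, if $\mathfrak{S},S'\vDash\psi$ then $\mathfrak{S},S'\vDash\varphi$. Write $\mathfrak{S}\vDash\varphi$ if $\mathfrak{S},S\vDash\varphi$ for all $S\in\mathfrak{S}$. A proof-theoretic system $\mathfrak{S}$ is called intuitionistic if every $S\in\mathfrak{S}$ contains the rule $\frac{\bot}{p}$ for every atomic proposition $p$ (with $\bot$ counted as atomic). A formula $\varphi$ is a generalised proof-theoretically valid formula if $\mathfrak{S}\vDash\varphi$ for every intuitionistic proof-theoretic system $\mathfrak{S}\subseteq\mathcal{P}(\mathbb{S})$. *)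

theory Defs
  imports Main "HOL-Library.Countable_Set"
begin

text \<open>The type variable \<open>'a\<close> is the set of atomic propositions; falsum is a further atomic symbol,
  so an element of \<open>'a atom\<close> is an element of ATOM together with falsum.\<close>

datatype 'a atom = Prop 'a | Falsum

datatype 'a form =
    Atomic "'a atom"
  | Conj "'a form" "'a form"
  | Disj "'a form" "'a form"
  | Imp "'a form" "'a form"

text \<open>\<open>Rule [p\<^sub>1, \<dots>, p\<^sub>n] q\<close> is the rule with premises \<open>p\<^sub>1, \<dots>, p\<^sub>n\<close> and conclusion \<open>q\<close>;
  \<open>Rule [] q\<close> is the axiom \<open>q\<close>.\<close>

datatype 'a atomic_rule = Rule "'a atom list" "'a atom"

type_synonym 'a atomic_system = "'a atomic_rule set"

type_synonym 'a proof_theoretic_system = "'a atomic_system set"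

inductive atomic_derivable :: "'a atomic_system \<Rightarrow> 'a atom \<Rightarrow> bool"
  for S :: "'a atomic_system" where
  apply_rule:
    "Rule ps q \<in> S \<Longrightarrow> (\<And>p. p \<in> set ps \<Longrightarrow> atomic_derivable S p) \<Longrightarrow> atomic_derivable S q"

text \<open>The relation is only meaningful for \<open>S \<in> \<SS>\<close>; it is total here because functions in HOL are.\<close>

primrec supports :: "'a proof_theoretic_system \<Rightarrow> 'a atomic_system \<Rightarrow> 'a form \<Rightarrow> bool" where
  "supports \<SS> S (Atomic p) \<longleftrightarrow> atomic_derivable S p"
| "supports \<SS> S (Conj \<phi> \<psi>) \<longleftrightarrow> supports \<SS> S \<phi> \<and> supports \<SS> S \<psi>"
| "supports \<SS> S (Disj \<phi> \<psi>) \<longleftrightarrow> supports \<SS> S \<phi> \<or> supports \<SS> S \<psi>"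
| "supports \<SS> S (Imp \<psi> \<phi>) \<longleftrightarrow>
     (\<forall>S'\<in>\<SS>. S \<subseteq> S' \<longrightarrow> supports \<SS> S' \<psi> \<longrightarrow> supports \<SS> S' \<phi>)"

definition valid_in :: "'a proof_theoretic_system \<Rightarrow> 'a form \<Rightarrow> bool" where
  "valid_in \<SS> \<phi> \<longleftrightarrow> (\<forall>S\<in>\<SS>. supports \<SS> S \<phi>)"

definition intuitionistic_system :: "'a proof_theoretic_system \<Rightarrow> bool" where
  "intuitionistic_system \<SS> \<longleftrightarrow> (\<forall>S\<in>\<SS>. \<forall>p. Rule [Falsum] p \<in> S)"

definition generalised_pt_valid :: "'a form \<Rightarrow> bool" where
  "generalised_pt_valid \<phi> \<longleftrightarrow> (\<forall>\<SS>. intuitionistic_system \<SS> \<longrightarrow> valid_in \<SS> \<phi>)"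

text \<open>Intuitionistic propositional logic as Gentzen's natural deduction calculus NJ, with
  negation understood as implication of falsum. Contexts are sets of open assumptions.\<close>

inductive NJ :: "'a form set \<Rightarrow> 'a form \<Rightarrow> bool" where
  Assm: "\<phi> \<in> \<Gamma> \<Longrightarrow> NJ \<Gamma> \<phi>"
| FalsumE: "NJ \<Gamma> (Atomic Falsum) \<Longrightarrow> NJ \<Gamma> \<phi>"
| ConjI: "NJ \<Gamma> \<phi> \<Longrightarrow> NJ \<Gamma> \<psi> \<Longrightarrow> NJ \<Gamma> (Conj \<phi> \<psi>)"
| ConjE1: "NJ \<Gamma> (Conj \<phi> \<psi>) \<Longrightarrow> NJ \<Gamma> \<phi>"
| ConjE2: "NJ \<Gamma> (Conj \<phi> \<psi>) \<Longrightarrow> NJ \<Gamma> \<psi>"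
| DisjI1: "NJ \<Gamma> \<phi> \<Longrightarrow> NJ \<Gamma> (Disj \<phi> \<psi>)"
| DisjI2: "NJ \<Gamma> \<psi> \<Longrightarrow> NJ \<Gamma> (Disj \<phi> \<psi>)"
| DisjE: "NJ \<Gamma> (Disj \<phi> \<psi>) \<Longrightarrow> NJ (insert \<phi> \<Gamma>) \<chi> \<Longrightarrow> NJ (insert \<psi> \<Gamma>) \<chi> \<Longrightarrow> NJ \<Gamma> \<chi>"
| ImpI: "NJ (insert \<phi> \<Gamma>) \<psi> \<Longrightarrow> NJ \<Gamma> (Imp \<phi> \<psi>)"
| ImpE: "NJ \<Gamma> (Imp \<phi> \<psi>) \<Longrightarrow> NJ \<Gamma> \<phi> \<Longrightarrow> NJ \<Gamma> \<psi>"

definition intuitionistic_theorem :: "'a form \<Rightarrow> bool" where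
  "intuitionistic_theorem \<phi> \<longleftrightarrow> NJ {} \<phi>"

end

theory Submission imports Defs
begin

text \<open>
  An intuitionistic proof-theoretic system, ordered by inclusion, is a Kripke model in which an atom
  holds at \<open>S\<close> when \<open>S\<close> derives it. Falsum may hold at a world, but then every formula holds there,
  because the world contains ex falso rules for all atoms. Soundness of NJ is therefore the usual
  induction on derivations, resting on monotonicity (\<open>supports_mono\<close>) and on explosion at worlds that
  derive falsum (\<open>supports_if_derivable_Falsum\<close>).

  For completeness, the canonical Kripke model must be realised as a proof-theoretic system. Its
  worlds are the prime theories ordered by inclusion, and \<open>\<phi>\<close> holds at \<open>\<Gamma>\<close> exactly when \<open>\<phi> \<in> \<Gamma>\<close>.
  Turning a prime theory into the atomic system of its atomic members gives the right atoms but loses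
  the order: two theories may be incomparable although their atoms are nested, and then the clause for
  implication would look at too many extensions. The remedy is to let the atomic system remember the
  whole theory by means of inert rules. A rule whose conclusion is among its premises
  contributes nothing to derivability, and there are infinitely many such rules, while there are only
  countably many formulas. So each formula can be given an inert rule of its own, and
  \<open>theory_system \<Gamma>\<close> contains the inert rules of the members of \<open>\<Gamma>\<close>. Inclusion of systems then
  coincides with inclusion of theories (\<open>theory_system_subset_iff\<close>), support coincides with membership
  (\<open>supports_canonical_system_iff\<close>), and a formula that is no theorem is missing from some prime
  theory (\<open>prime_theory_extension\<close>), hence fails in the canonical system.
\<close>

section \<open>Soundness\<close>

lemma atomic_derivable_mono:
  "atomic_derivable S p \<Longrightarrow> S \<subseteq> T \<Longrightarrow> atomic_derivable T p"
  by (induction rule: atomic_derivable.induct) (meson atomic_derivable.apply_rule subsetD)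

lemma supports_mono:
  "supports \<SS> S \<phi> \<Longrightarrow> S \<subseteq> T \<Longrightarrow> supports \<SS> T \<phi>"
  by (induction \<phi>) (auto intro: atomic_derivable_mono)

text \<open>Explosion for atoms is what the ex falso rules provide. It extends to implications
  because falsum stays derivable at every extension, so that their succedents are supported there.\<close>

lemma supports_if_derivable_Falsum:
  assumes "intuitionistic_system \<SS>" "S \<in> \<SS>" "atomic_derivable S Falsum"
  shows "supports \<SS> S \<phi>"
  using assms(2,3)
proof (induction \<phi> arbitrary: S)
  case (Atomic p)
  have "Rule [Falsum] p \<in> S"
    using assms(1) Atomic.prems(1) by (auto simp: intuitionistic_system_def)
  then show ?case
    using Atomic.prems(2) by (auto intro: atomic_derivable.apply_rule)
qed (auto intro: atomic_derivable_mono)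

lemma NJ_sound:
  assumes "NJ \<Gamma> \<phi>" "intuitionistic_system \<SS>" "S \<in> \<SS>" "\<And>\<psi>. \<psi> \<in> \<Gamma> \<Longrightarrow> supports \<SS> S \<psi>"
  shows "supports \<SS> S \<phi>"
  using assms(1,3,4)
proof (induction arbitrary: S rule: NJ.induct)
  case (FalsumE \<Gamma> \<phi>)
  then have "supports \<SS> S (Atomic Falsum)" by blast
  then show ?case using supports_if_derivable_Falsum[OF assms(2)] FalsumE.prems(1) by simp
next
  case (DisjE \<Gamma> \<phi> \<psi> \<chi>)
  then have "supports \<SS> S (Disj \<phi> \<psi>)" by blast
  then consider "supports \<SS> S \<phi>" | "supports \<SS> S \<psi>" by auto
  then show ?case using DisjE by cases blast+
next
  case (ImpI \<phi> \<Gamma> \<psi>)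
  then show ?case by (auto intro: supports_mono)
next
  case (ImpE \<Gamma> \<phi> \<psi>)
  then have "supports \<SS> S (Imp \<phi> \<psi>)" "supports \<SS> S \<phi>" by blast+
  then show ?case using ImpE.prems(1) by auto
qed auto

section \<open>Structural properties of natural deduction\<close>

lemma NJ_weaken: "NJ \<Gamma> \<phi> \<Longrightarrow> \<Gamma> \<subseteq> \<Delta> \<Longrightarrow> NJ \<Delta> \<phi>"
proof (induction arbitrary: \<Delta> rule: NJ.induct)
  case (DisjE \<Gamma> \<phi> \<psi> \<chi>)
  then show ?case by (meson NJ.DisjE insert_mono)
next
  case (ImpI \<phi> \<Gamma> \<psi>)
  then show ?case by (meson NJ.ImpI insert_mono)
next
  case Assm
  then show ?case by (blast intro: NJ.Assm)
next
  case FalsumE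
  then show ?case by (metis NJ.FalsumE)
next
  case ConjE1
  then show ?case by (metis NJ.ConjE1)
next
  case ConjE2
  then show ?case by (metis NJ.ConjE2)
next
  case ImpE
  then show ?case by (metis NJ.ImpE)
qed (simp_all add: NJ.ConjI NJ.DisjI1 NJ.DisjI2)

lemma NJ_cut: "NJ \<Gamma> \<phi> \<Longrightarrow> NJ (insert \<phi> \<Gamma>) \<psi> \<Longrightarrow> NJ \<Gamma> \<psi>"
  by (rule NJ.ImpE[OF NJ.ImpI])

lemma NJ_compact:
  assumes "NJ \<Gamma> \<phi>"
  shows "\<exists>\<Gamma>\<^sub>0. finite \<Gamma>\<^sub>0 \<and> \<Gamma>\<^sub>0 \<subseteq> \<Gamma> \<and> NJ \<Gamma>\<^sub>0 \<phi>"
  using assms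
proof (induction rule: NJ.induct)
  case (Assm \<phi> \<Gamma>)
  then show ?case by (intro exI[of _ "{\<phi>}"]) (auto intro: NJ.Assm)
next
  case (ConjI \<Gamma> \<phi> \<psi>)
  then obtain A B where *: "finite A" "A \<subseteq> \<Gamma>" "NJ A \<phi>" "finite B" "B \<subseteq> \<Gamma>" "NJ B \<psi>" by blast
  have "NJ (A \<union> B) \<phi>" using *(3) by (rule NJ_weaken) blast
  moreover have "NJ (A \<union> B) \<psi>" using *(6) by (rule NJ_weaken) blast
  ultimately have "NJ (A \<union> B) (Conj \<phi> \<psi>)" by (rule NJ.ConjI)
  then show ?case using * by (intro exI[of _ "A \<union> B"]) auto
next
  case (DisjE \<Gamma> \<phi> \<psi> \<chi>)
  from DisjE.IH(1) obtain A where A: "finite A" "A \<subseteq> \<Gamma>" "NJ A (Disj \<phi> \<psi>)" by blast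
  from DisjE.IH(2) obtain B where B: "finite B" "B \<subseteq> insert \<phi> \<Gamma>" "NJ B \<chi>" by blast
  from DisjE.IH(3) obtain C where C: "finite C" "C \<subseteq> insert \<psi> \<Gamma>" "NJ C \<chi>" by blast
  let ?D = "A \<union> (B - {\<phi>}) \<union> (C - {\<psi>})"
  have "NJ ?D (Disj \<phi> \<psi>)" using A(3) by (rule NJ_weaken) blast
  moreover have "NJ (insert \<phi> ?D) \<chi>" using B(3) by (rule NJ_weaken) blast
  moreover have "NJ (insert \<psi> ?D) \<chi>" using C(3) by (rule NJ_weaken) blast
  ultimately have "NJ ?D \<chi>" by (rule NJ.DisjE)
  moreover have "finite ?D" using A(1) B(1) C(1) by simp
  moreover have "?D \<subseteq> \<Gamma>"
    using A(2) B(2) C(2) by (simp add: Diff_subset_conv)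
  ultimately show ?case by (intro exI[of _ ?D] conjI)
next
  case (ImpI \<phi> \<Gamma> \<psi>)
  then obtain A where *: "finite A" "A \<subseteq> insert \<phi> \<Gamma>" "NJ A \<psi>" by blast
  have "NJ (insert \<phi> (A - {\<phi>})) \<psi>" using *(3) by (rule NJ_weaken) blast
  then have "NJ (A - {\<phi>}) (Imp \<phi> \<psi>)" by (rule NJ.ImpI)
  then show ?case using * by (intro exI[of _ "A - {\<phi>}"]) auto
next
  case (ImpE \<Gamma> \<phi> \<psi>)
  then obtain A B where *: "finite A" "A \<subseteq> \<Gamma>" "NJ A (Imp \<phi> \<psi>)" "finite B" "B \<subseteq> \<Gamma>" "NJ B \<phi>"
    by blast
  have "NJ (A \<union> B) (Imp \<phi> \<psi>)" using *(3) by (rule NJ_weaken) blast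
  moreover have "NJ (A \<union> B) \<phi>" using *(6) by (rule NJ_weaken) blast
  ultimately have "NJ (A \<union> B) \<psi>" by (rule NJ.ImpE)
  then show ?case using * by (intro exI[of _ "A \<union> B"]) auto
next
  case FalsumE
  then show ?case by (metis NJ.FalsumE)
next
  case ConjE1
  then show ?case by (fast dest: NJ.ConjE1)
next
  case ConjE2
  then show ?case by (fast dest: NJ.ConjE2)
next
  case DisjI1
  then show ?case by (fast intro: NJ.DisjI1)
next
  case DisjI2
  then show ?case by (fast intro: NJ.DisjI2)
qed

section \<open>Prime theories\<close>

text \<open>The set of all formulas counts as a prime theory. It serves as the world at which falsum
  is supported; its atomic system derives falsum and so supports every formula.\<close>

definition prime_theory :: "'a form set \<Rightarrow> bool" where
  "prime_theory \<Gamma> \<longleftrightarrow> (\<forall>\<phi>. NJ \<Gamma> \<phi> \<longrightarrow> \<phi> \<in> \<Gamma>) \<and>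
     (\<forall>\<phi> \<psi>. Disj \<phi> \<psi> \<in> \<Gamma> \<longrightarrow> \<phi> \<in> \<Gamma> \<or> \<psi> \<in> \<Gamma>)"

lemma prime_theory_closed: "prime_theory \<Gamma> \<Longrightarrow> NJ \<Gamma> \<phi> \<longleftrightarrow> \<phi> \<in> \<Gamma>"
  by (auto simp: prime_theory_def intro: NJ.Assm)

lemma prime_theory_Disj_iff:
  "prime_theory \<Gamma> \<Longrightarrow> Disj \<phi> \<psi> \<in> \<Gamma> \<longleftrightarrow> \<phi> \<in> \<Gamma> \<or> \<psi> \<in> \<Gamma>"
  unfolding prime_theory_def by (meson NJ.Assm NJ.DisjI1 NJ.DisjI2)

lemma prime_theory_Conj_iff:
  "prime_theory \<Gamma> \<Longrightarrow> Conj \<phi> \<psi> \<in> \<Gamma> \<longleftrightarrow> \<phi> \<in> \<Gamma> \<and> \<psi> \<in> \<Gamma>"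
  unfolding prime_theory_def by (meson NJ.Assm NJ.ConjI NJ.ConjE1 NJ.ConjE2)

text \<open>A set that is maximal among those that do not prove \<open>\<phi>\<close> is prime: adding any formula outside it
  makes \<open>\<phi>\<close> provable, so if it contained a disjunction without either disjunct, disjunction
  elimination would prove \<open>\<phi>\<close>. Compactness makes Zorn's lemma applicable.\<close>

lemma prime_theory_extension:
  assumes "\<not> NJ \<Gamma> \<phi>"
  obtains \<Delta> where "prime_theory \<Delta>" "\<Gamma> \<subseteq> \<Delta>" "\<phi> \<notin> \<Delta>"
proof -
  let ?A = "{\<Delta>. \<Gamma> \<subseteq> \<Delta> \<and> \<not> NJ \<Delta> \<phi>}"
  have "\<exists>\<Delta>\<in>?A. \<forall>X\<in>?A. \<Delta> \<subseteq> X \<longrightarrow> X = \<Delta>"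
  proof (rule subset_Zorn_nonempty)
    show "?A \<noteq> {}" using assms by blast
  next
    fix C assume C: "C \<noteq> {}" "subset.chain ?A C"
    then have sub: "C \<subseteq> ?A" by (simp add: subset.chain_def)
    have "\<not> NJ (\<Union>C) \<phi>"
    proof
      assume "NJ (\<Union>C) \<phi>"
      then obtain F where F: "finite F" "F \<subseteq> \<Union>C" "NJ F \<phi>" using NJ_compact by blast
      then obtain \<Delta> where "\<Delta> \<in> C" "F \<subseteq> \<Delta>"
        using finite_subset_Union_chain[OF F(1,2) C] by blast
      then have "NJ \<Delta> \<phi>" using F(3) by (simp add: NJ_weaken)
      then show False using \<open>\<Delta> \<in> C\<close> sub by auto
    qed
    moreover have "\<Gamma> \<subseteq> \<Union>C" using C(1) sub by fast
    ultimately show "\<Union>C \<in> ?A" by blast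
  qed
  then obtain \<Delta> where "\<Delta> \<in> ?A" and max: "\<forall>X\<in>?A. \<Delta> \<subseteq> X \<longrightarrow> X = \<Delta>" by (rule bexE)
  then have \<Delta>: "\<Gamma> \<subseteq> \<Delta>" "\<not> NJ \<Delta> \<phi>" by simp_all
  have outside: "NJ (insert \<psi> \<Delta>) \<phi>" if "\<psi> \<notin> \<Delta>" for \<psi>
  proof (rule ccontr)
    assume "\<not> ?thesis"
    then have "insert \<psi> \<Delta> \<in> ?A" using \<Delta>(1) by auto
    then have "insert \<psi> \<Delta> = \<Delta>" using max by (simp add: subset_insertI)
    then show False using that by blast
  qed
  have "prime_theory \<Delta>"
    unfolding prime_theory_def
  proof (intro conjI allI impI)
    show "\<psi> \<in> \<Delta>" if "NJ \<Delta> \<psi>" for \<psi>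
      using outside NJ_cut[OF that] \<Delta>(2) by blast
  next
    show "\<psi> \<in> \<Delta> \<or> \<chi> \<in> \<Delta>" if "Disj \<psi> \<chi> \<in> \<Delta>" for \<psi> \<chi>
      using outside NJ.DisjE[OF NJ.Assm[OF that]] \<Delta>(2) by blast
  qed
  moreover have "\<phi> \<notin> \<Delta>" using \<Delta>(2) NJ.Assm by blast
  ultimately show thesis using that \<Delta>(1) by blast
qed

text \<open>If \<open>\<Gamma>\<close> lacks the implication, then \<open>\<Gamma>\<close> with \<open>\<phi>\<close> added does not prove \<open>\<psi>\<close>, and a prime
  extension of it without \<open>\<psi>\<close> refutes the right-hand side.\<close>

lemma prime_theory_Imp_iff:
  assumes "prime_theory \<Gamma>"
  shows "Imp \<phi> \<psi> \<in> \<Gamma> \<longleftrightarrow> (\<forall>\<Delta>. prime_theory \<Delta> \<longrightarrow> \<Gamma> \<subseteq> \<Delta> \<longrightarrow> \<phi> \<in> \<Delta> \<longrightarrow> \<psi> \<in> \<Delta>)"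
proof
  assume "Imp \<phi> \<psi> \<in> \<Gamma>"
  then show "\<forall>\<Delta>. prime_theory \<Delta> \<longrightarrow> \<Gamma> \<subseteq> \<Delta> \<longrightarrow> \<phi> \<in> \<Delta> \<longrightarrow> \<psi> \<in> \<Delta>"
    by (meson NJ.Assm NJ.ImpE prime_theory_closed subsetD)
next
  assume *: "\<forall>\<Delta>. prime_theory \<Delta> \<longrightarrow> \<Gamma> \<subseteq> \<Delta> \<longrightarrow> \<phi> \<in> \<Delta> \<longrightarrow> \<psi> \<in> \<Delta>"
  have "NJ (insert \<phi> \<Gamma>) \<psi>"
    using * by (meson insert_subset prime_theory_extension)
  then show "Imp \<phi> \<psi> \<in> \<Gamma>" using assms NJ.ImpI prime_theory_closed by blast
qed

section \<open>Prime theories as atomic systems\<close>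

text \<open>An injective numbering of the atomic propositions extends to all formulas; this is where
  countability enters, as the inert rules below are indexed by natural numbers.\<close>

primrec atom_code :: "('a \<Rightarrow> nat) \<Rightarrow> 'a atom \<Rightarrow> nat" where
  "atom_code c (Prop a) = Suc (c a)"
| "atom_code c Falsum = 0"

primrec form_code :: "('a \<Rightarrow> nat) \<Rightarrow> 'a form \<Rightarrow> nat" where
  "form_code c (Atomic p) = prod_encode (0, atom_code c p)"
| "form_code c (Conj \<phi> \<psi>) = prod_encode (1, prod_encode (form_code c \<phi>, form_code c \<psi>))"
| "form_code c (Disj \<phi> \<psi>) = prod_encode (2, prod_encode (form_code c \<phi>, form_code c \<psi>))"
| "form_code c (Imp \<phi> \<psi>) = prod_encode (3, prod_encode (form_code c \<phi>, form_code c \<psi>))"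

lemma inj_form_code:
  assumes "inj c"
  shows "inj (form_code c)"
proof (rule injI)
  have atom: "atom_code c p = atom_code c q \<Longrightarrow> p = q" for p q
    using assms by (cases p; cases q) (auto dest: injD)
  show "form_code c \<phi> = form_code c \<psi> \<Longrightarrow> \<phi> = \<psi>" for \<phi> \<psi>
  proof (induction \<phi> arbitrary: \<psi>)
    case (Atomic p)
    then show ?case by (cases \<psi>) (auto dest: atom)
  next
    case (Conj \<phi>1 \<phi>2)
    then show ?case by (cases \<psi>) auto
  next
    case (Disj \<phi>1 \<phi>2)
    then show ?case by (cases \<psi>) auto
  next
    case (Imp \<phi>1 \<phi>2)
    then show ?case by (cases \<psi>) auto
  qed
qed

text \<open>Inert rules have falsum as conclusion and as every premise. At least two premises are
  used because falsum from a single falsum is one of the ex falso rules, which every system has, so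
  it could not tell two theories apart.\<close>

definition inert_rule :: "nat \<Rightarrow> 'a atomic_rule" where
  "inert_rule n = Rule (replicate (n + 2) Falsum) Falsum"

lemma inert_rule_eq_iff [simp]: "inert_rule m = inert_rule n \<longleftrightarrow> m = n"
  by (auto simp: inert_rule_def dest: arg_cong[where f = length])

lemma inert_rule_neq [simp]: "inert_rule n \<noteq> Rule [] p" "inert_rule n \<noteq> Rule [q] p"
  by (simp_all add: inert_rule_def)

definition theory_system :: "('a form \<Rightarrow> nat) \<Rightarrow> 'a form set \<Rightarrow> 'a atomic_system" where
  "theory_system f \<Gamma> = range (Rule [Falsum]) \<union> {Rule [] p |p. Atomic p \<in> \<Gamma>} \<union>
     (\<lambda>\<phi>. inert_rule (f \<phi>)) ` \<Gamma>"

lemma theory_system_subset_iff: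
  assumes "inj f"
  shows "theory_system f \<Gamma> \<subseteq> theory_system f \<Delta> \<longleftrightarrow> \<Gamma> \<subseteq> \<Delta>"
proof
  have inert_in: "inert_rule (f \<phi>) \<in> theory_system f \<Theta> \<longleftrightarrow> \<phi> \<in> \<Theta>" for \<phi> \<Theta>
    by (auto simp: theory_system_def dest: injD[OF assms])
  show "\<Gamma> \<subseteq> \<Delta>" if "theory_system f \<Gamma> \<subseteq> theory_system f \<Delta>"
    using that inert_in by blast
qed (auto simp: theory_system_def)

text \<open>Beyond the axioms for members of \<open>\<Gamma>\<close>, every rule of the system, be it inert or ex falso, has
  falsum among its premises. It can only fire when falsum is in \<open>\<Gamma>\<close>, which then contains all atoms.\<close>

lemma atomic_derivable_theory_system_iff:
  assumes "prime_theory \<Gamma>"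
  shows "atomic_derivable (theory_system f \<Gamma>) p \<longleftrightarrow> Atomic p \<in> \<Gamma>"
proof
  assume "atomic_derivable (theory_system f \<Gamma>) p"
  then show "Atomic p \<in> \<Gamma>"
  proof (induction rule: atomic_derivable.induct)
    case (apply_rule ps q)
    have "(ps = [] \<and> Atomic q \<in> \<Gamma>) \<or> Falsum \<in> set ps"
      using apply_rule.hyps(1) by (auto simp: theory_system_def inert_rule_def)
    then have "Atomic q \<in> \<Gamma> \<or> Atomic Falsum \<in> \<Gamma>"
      using apply_rule.IH[of Falsum] by blast
    moreover have "Atomic q \<in> \<Gamma>" if "Atomic Falsum \<in> \<Gamma>"
      using NJ.FalsumE[OF NJ.Assm[OF that]] prime_theory_closed[OF assms] by simp
    ultimately show ?case by blast
  qed
next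
  assume "Atomic p \<in> \<Gamma>"
  then have "Rule [] p \<in> theory_system f \<Gamma>" by (auto simp: theory_system_def)
  then show "atomic_derivable (theory_system f \<Gamma>) p"
    by (rule atomic_derivable.apply_rule) simp
qed

definition canonical_system :: "('a form \<Rightarrow> nat) \<Rightarrow> 'a proof_theoretic_system" where
  "canonical_system f = theory_system f ` {\<Gamma>. prime_theory \<Gamma>}"

lemma intuitionistic_canonical_system: "intuitionistic_system (canonical_system f)"
  by (auto simp: intuitionistic_system_def canonical_system_def theory_system_def)

text \<open>The truth lemma of the canonical Kripke model, transported along \<open>theory_system f\<close>.\<close>

lemma supports_canonical_system_iff:
  assumes "inj f" "prime_theory \<Gamma>"
  shows "supports (canonical_system f) (theory_system f \<Gamma>) \<phi> \<longleftrightarrow> \<phi> \<in> \<Gamma>"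
  using assms(2)
proof (induction \<phi> arbitrary: \<Gamma>)
  case (Atomic p)
  then show ?case by (simp add: atomic_derivable_theory_system_iff)
next
  case (Conj \<phi> \<psi>)
  then show ?case by (simp add: prime_theory_Conj_iff)
next
  case (Disj \<phi> \<psi>)
  then show ?case by (simp add: prime_theory_Disj_iff)
next
  case (Imp \<phi> \<psi>)
  \<comment> \<open>The extensions of this world in the canonical system are exactly the prime extensions of \<open>\<Gamma>\<close>.\<close>
  have "supports (canonical_system f) (theory_system f \<Gamma>) (Imp \<phi> \<psi>) \<longleftrightarrow>
      (\<forall>\<Delta>. prime_theory \<Delta> \<longrightarrow> \<Gamma> \<subseteq> \<Delta> \<longrightarrow> \<phi> \<in> \<Delta> \<longrightarrow> \<psi> \<in> \<Delta>)"
    using Imp.IH by (auto simp: canonical_system_def theory_system_subset_iff[OF assms(1)])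
  also have "\<dots> \<longleftrightarrow> Imp \<phi> \<psi> \<in> \<Gamma>" using prime_theory_Imp_iff[OF Imp.prems] by simp
  finally show ?case .
qed

section \<open>Generalised proof-theoretic validity is intuitionistic validity\<close>

theorem theorem1p1:
  fixes \<phi> :: "'a form"
  assumes "countable (UNIV :: 'a set)" and "infinite (UNIV :: 'a set)"
  shows "generalised_pt_valid \<phi> \<longleftrightarrow> intuitionistic_theorem \<phi>"
proof
  assume valid: "generalised_pt_valid \<phi>"
  from assms(1) obtain c :: "'a \<Rightarrow> nat" where "inj c" by (auto simp: countable_def)
  then have inj: "inj (form_code c)" by (rule inj_form_code)
  show "intuitionistic_theorem \<phi>"
  proof (rule ccontr)
    assume "\<not> intuitionistic_theorem \<phi>"
    then obtain \<Gamma> where \<Gamma>: "prime_theory \<Gamma>" "\<phi> \<notin> \<Gamma>"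
      unfolding intuitionistic_theorem_def using prime_theory_extension by metis
    have "supports (canonical_system (form_code c)) (theory_system (form_code c) \<Gamma>) \<phi>"
      using valid intuitionistic_canonical_system \<Gamma>(1)
      unfolding generalised_pt_valid_def valid_in_def canonical_system_def by blast
    then show False using supports_canonical_system_iff[OF inj \<Gamma>(1)] \<Gamma>(2) by simp
  qed
next
  assume "intuitionistic_theorem \<phi>"
  then show "generalised_pt_valid \<phi>"
    by (auto simp: intuitionistic_theorem_def generalised_pt_valid_def valid_in_def intro: NJ_sound)
qed

end
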